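(* Let $S_1$ be a primitive non-powerful signed digraph of order $n$ whose underlying digraph is $D_1$. Then for every integer $k$ with $1 \le k \le n$, $L(S_1,k) = (2n-k)(n-1)+1$.
   Context: A signed digraph $S$ is a digraph (loops allowed, no multiple arcs) on a finite vertex set in which each arc is assigned a sign $1$ or $-1$; its underlying digraph is obtained by forgetting the signs, and its order is its number of vertices. A walk of length $m$ is a sequence of arcs $e_1,\dots,e_m$ such that the terminal vertex of $e_i$ is the initial vertex of $e_{i+1}$; for each vertex $u$ there is also the trivial walk of length $0$ from $u$ to $u$. The sign of a walk is the product of the signs of its arcs (the trivial walk has sign $1$). Two walks form a pair of SSSD walks if they have the same initial vertex, the same terminal vertex, the same length, but different signs. A digraph $D$ is primitive if there is a positive integer $m$ such that for every ordered pair $(u,v)$ of vertices there is a walk of length $m$ from $u$ to $v$; a signed digraph is primitive if its underlying digraph is. A signed digraph is non-powerful if it contains a pair of SSSD walks. For a primitive non-powerful signed digraph $S$ and $X \subseteq V(S)$, $l_S(X)$ is the least integer $p\ge 0$ such that for every vertex $v$ of $S$ there exist $x\in X$ and a pair of SSSD walks of length $p$ from $x$ to $v$; the $k$th upper base is $L(S,k)=\max\{l_S(X) : X\subseteq V(S),\ |X|=k\}$. $D_1$ is the digraph with vertex set $\{1,\dots,n\}$ and arcs $(i,i+1)$ for $1\le i\le n-1$, $(n,1)$ and $(n-1,1)$. *)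

theory Defs
  imports "Graph_Theory.Pair_Digraph"
begin

text \<open>Arcs are pairs of vertices, so loops are possible but multiple arcs are not.
  Signs outside the arc set of the underlying digraph are irrelevant.\<close>

record 'a signed_digraph =
  underlying :: "'a pair_pre_digraph"
  arc_sign :: "'a \<times> 'a \<Rightarrow> int"

definition is_signed_digraph :: "'a signed_digraph \<Rightarrow> bool" where
  "is_signed_digraph S \<longleftrightarrow>
     pair_fin_digraph (underlying S) \<and> (\<forall>e \<in> parcs (underlying S). arc_sign S e \<in> {1, -1})"

abbreviation vertices :: "'a signed_digraph \<Rightarrow> 'a set" where
  "vertices S \<equiv> pverts (underlying S)"

definition walk :: "'a pair_pre_digraph \<Rightarrow> 'a \<Rightarrow> ('a \<times> 'a) list \<Rightarrow> 'a \<Rightarrow> bool" where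
  "walk D u w v \<longleftrightarrow> pre_digraph.awalk (with_proj D) u w v"

definition walk_sign :: "'a signed_digraph \<Rightarrow> ('a \<times> 'a) list \<Rightarrow> int" where
  "walk_sign S w = prod_list (map (arc_sign S) w)"

text \<open>The walks \<open>w\<close> and \<open>w'\<close> are a pair of SSSD walks of length \<open>p\<close> from \<open>u\<close> to \<open>v\<close>.\<close>

definition SSSD_pair ::
  "'a signed_digraph \<Rightarrow> nat \<Rightarrow> 'a \<Rightarrow> 'a \<Rightarrow> ('a \<times> 'a) list \<Rightarrow> ('a \<times> 'a) list \<Rightarrow> bool" where
  "SSSD_pair S p u v w w' \<longleftrightarrow>
     walk (underlying S) u w v \<and> walk (underlying S) u w' v \<and>
     length w = p \<and> length w' = p \<and> walk_sign S w \<noteq> walk_sign S w'"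

definition primitive_digraph :: "'a pair_pre_digraph \<Rightarrow> bool" where
  "primitive_digraph D \<longleftrightarrow>
     (\<exists>m>0. \<forall>u \<in> pverts D. \<forall>v \<in> pverts D. \<exists>w. walk D u w v \<and> length w = m)"

definition primitive :: "'a signed_digraph \<Rightarrow> bool" where
  "primitive S \<longleftrightarrow> primitive_digraph (underlying S)"

definition non_powerful :: "'a signed_digraph \<Rightarrow> bool" where
  "non_powerful S \<longleftrightarrow> (\<exists>p u v w w'. SSSD_pair S p u v w w')"

text \<open>Meaningful when some such \<open>p\<close> exists, in particular for primitive non-powerful
  \<open>S\<close> and nonempty \<open>X \<subseteq> vertices S\<close>.\<close>

definition l_base :: "'a signed_digraph \<Rightarrow> 'a set \<Rightarrow> nat" where
  "l_base S X = (LEAST p. \<forall>v \<in> vertices S. \<exists>x \<in> X. \<exists>w w'. SSSD_pair S p x v w w')"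

definition upper_base :: "'a signed_digraph \<Rightarrow> nat \<Rightarrow> nat" where
  "upper_base S k = Max {l_base S X | X. X \<subseteq> vertices S \<and> card X = k}"

text \<open>For \<open>n < 2\<close> the listed arcs are not all between vertices, so \<open>D1 n\<close> is then not
  a digraph and no signed digraph has it as underlying digraph.\<close>

definition D1 :: "nat \<Rightarrow> nat pair_pre_digraph" where
  "D1 n = \<lparr> pverts = {1..n},
            parcs = {(i, i + 1) | i. 1 \<le> i \<and> i \<le> n - 1} \<union> {(n, 1), (n - 1, 1)} \<rparr>"

end

theory Submission
  imports Defs
begin

text \<open>A walk from \<open>u\<close> to \<open>v\<close> in \<open>D1 n\<close> is described by the numbers \<open>p\<close> and \<open>q\<close> of its arcs
  \<open>(n - 1, 1)\<close> and \<open>(n, 1)\<close>: its length is \<open>v - u + p (n - 1) + q n\<close> and its sign is, up to a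
  factor depending on \<open>u\<close> and \<open>v\<close> only, \<open>a ^ p * b ^ q\<close>, where \<open>a\<close> and \<open>b\<close> are the signs of the
  two cycles. Walks with the same ends and length thus differ by exchanging \<open>n\<close> short cycles for
  \<open>n - 1\<close> long ones, so non-powerfulness means \<open>a ^ n \<noteq> b ^ (n - 1)\<close>, and SSSD walks of length
  \<open>m\<close> from \<open>u\<close> to \<open>v\<close> exist iff \<open>m - n (n - 1) + (u mod n) - v\<close> lies in the numerical semigroup
  generated by \<open>n - 1\<close> and \<open>n\<close>, which is the union of the intervals \<open>[j (n - 1), j n]\<close>.
  At length \<open>(2 n - k) (n - 1) + 1\<close> each \<open>v\<close> is missed by at most \<open>k - 1\<close> vertices \<open>u\<close>, whereas at
  length \<open>(2 n - k) (n - 1)\<close> the last \<open>k\<close> vertices all miss \<open>v = n\<close>.\<close>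

section \<open>Walks and their signs, arc by arc\<close>

lemma walk_Nil: "walk D u [] v \<longleftrightarrow> u = v \<and> u \<in> pverts D"
  by (auto simp: walk_def pre_digraph.awalk_def pre_digraph.cas.simps)

lemma walk_Cons:
  assumes "pair_fin_digraph D"
  shows "walk D u (e # w) v \<longleftrightarrow> (\<exists>x. e = (u, x) \<and> (u, x) \<in> parcs D \<and> walk D x w v)"
proof -
  interpret pair_fin_digraph D by fact
  show ?thesis
    unfolding walk_def awalk_Cons_iff by (cases e) force
qed

lemma walk_sign_Cons: "walk_sign S (e # w) = arc_sign S e * walk_sign S w"
  by (simp add: walk_sign_def)

section \<open>Arcs, path signs and cycle signs\<close>

locale signed_D1 =
  fixes S :: "nat signed_digraph" and n :: nat
  assumes signed: "is_signed_digraph S" and underlying: "underlying S = D1 n"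
begin

lemma fin_digraph: "pair_fin_digraph (D1 n)"
  using signed underlying by (auto simp: is_signed_digraph_def)

lemma n_ge_2: "2 \<le> n"
proof -
  interpret pair_fin_digraph "D1 n" by (rule fin_digraph)
  have "(n - 1, 1) \<in> parcs (D1 n)" by (simp add: D1_def)
  then have "n - 1 \<in> pverts (D1 n)" by (rule in_arcsD1)
  then show ?thesis by (simp add: D1_def)
qed

lemma verts_eq: "pverts (D1 n) = {1..n}"
  by (simp add: D1_def)

lemma arc_iff:
  "(u, x) \<in> parcs (D1 n) \<longleftrightarrow>
     1 \<le> u \<and> u < n \<and> x = u + 1 \<or> u = n \<and> x = 1 \<or> u = n - 1 \<and> x = 1"
  using n_ge_2 by (auto simp: D1_def)

lemma arc_sign_square: "e \<in> parcs (D1 n) \<Longrightarrow> arc_sign S e * arc_sign S e = 1"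
  using signed underlying by (auto simp: is_signed_digraph_def)

text \<open>A potential on the vertices: its values up to \<open>n\<close> square to 1, so the sign
  of a path arc is the product of the potentials at its two ends, and along a walk these factors
  telescope to those of its endpoints.\<close>

definition path_sign :: "nat \<Rightarrow> int" where
  "path_sign u = (\<Prod>i = 1..<u. arc_sign S (i, i + 1))"

definition short_cycle_sign :: int where
  "short_cycle_sign = path_sign (n - 1) * arc_sign S (n - 1, 1)"

definition long_cycle_sign :: int where
  "long_cycle_sign = path_sign n * arc_sign S (n, 1)"

lemma path_sign_1: "path_sign 1 = 1"
  by (simp add: path_sign_def)

lemma path_sign_Suc: "1 \<le> u \<Longrightarrow> path_sign (Suc u) = path_sign u * arc_sign S (u, Suc u)"
  by (simp add: path_sign_def)

lemma path_sign_square: "u \<le> n \<Longrightarrow> path_sign u * path_sign u = 1"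
  unfolding path_sign_def prod.distrib[symmetric]
  by (intro prod.neutral ballI arc_sign_square) (auto simp: arc_iff)

lemma arc_sign_path:
  assumes "1 \<le> u" "u < n"
  shows "arc_sign S (u, Suc u) = path_sign u * path_sign (Suc u)"
  using assms path_sign_square[of u] by (simp add: path_sign_Suc mult.assoc[symmetric])

lemma arc_sign_path_mult:
  assumes "1 \<le> u" "u < n"
  shows "arc_sign S (u, Suc u) * path_sign (Suc u) = path_sign u"
proof -
  have "arc_sign S (u, Suc u) * path_sign (Suc u) = path_sign u * (path_sign (Suc u) * path_sign (Suc u))"
    by (simp only: arc_sign_path[OF assms] mult.assoc)
  then show ?thesis using assms by (simp only: path_sign_square Suc_leI mult_1_right)
qed

lemma arc_sign_short: "arc_sign S (n - 1, 1) = path_sign (n - 1) * short_cycle_sign"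
  using path_sign_square[of "n - 1"] by (simp add: short_cycle_sign_def mult.assoc[symmetric])

lemma arc_sign_long: "arc_sign S (n, 1) = path_sign n * long_cycle_sign"
  using path_sign_square[of n] by (simp add: long_cycle_sign_def mult.assoc[symmetric])

lemma short_cycle_sign_nz: "short_cycle_sign \<noteq> 0"
  using path_sign_square[of "n - 1"] arc_sign_square[of "(n - 1, 1)"]
  by (auto simp: short_cycle_sign_def arc_iff)

lemma long_cycle_sign_nz: "long_cycle_sign \<noteq> 0"
  using path_sign_square[of n] arc_sign_square[of "(n, 1)"]
  by (auto simp: long_cycle_sign_def arc_iff)

lemma path_sign_nz: "u \<le> n \<Longrightarrow> path_sign u \<noteq> 0"
  using path_sign_square[of u] by auto

text \<open>The last conjunct: a walk leaving \<open>n\<close> starts with the arc \<open>(n, 1)\<close>.\<close>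

definition cycle_counts :: "nat \<Rightarrow> nat \<Rightarrow> nat \<Rightarrow> nat \<Rightarrow> nat \<Rightarrow> bool" where
  "cycle_counts m u v p q \<longleftrightarrow>
     m + u = v + p * (n - 1) + q * n \<and> (u = n \<longrightarrow> 0 < p \<longrightarrow> 0 < q)"

section \<open>Walks correspond to admissible cycle counts\<close>

lemma walk_imp_cycle_counts:
  assumes "walk (D1 n) u w v"
  shows "\<exists>p q. cycle_counts (length w) u v p q \<and>
    walk_sign S w = path_sign u * path_sign v * short_cycle_sign ^ p * long_cycle_sign ^ q"
  using assms
proof (induction w arbitrary: u)
  case Nil
  then have "u = v" "u \<le> n" by (simp_all add: walk_Nil verts_eq)
  then show ?case
    using path_sign_square[of u]
    by (intro exI[of _ 0]) (simp add: cycle_counts_def walk_sign_def)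
next
  case (Cons e w)
  then obtain x where e: "e = (u, x)" and arc: "(u, x) \<in> parcs (D1 n)" and w: "walk (D1 n) x w v"
    by (auto simp: walk_Cons[OF fin_digraph])
  obtain p q where counts: "cycle_counts (length w) x v p q"
    and sign: "walk_sign S w = path_sign x * path_sign v * short_cycle_sign ^ p * long_cycle_sign ^ q"
    using Cons.IH[OF w] by blast
  \<comment> \<open>Each kind of arc then only has to supply its updated counts; the potential at
    the intermediate vertex \<open>x\<close> is absorbed by the sign of the first arc.\<close>
  have step: ?case
    if "cycle_counts (Suc (length w)) u v p' q'"
      and sign': "arc_sign S (u, x) * path_sign x * short_cycle_sign ^ p * long_cycle_sign ^ q =
        path_sign u * short_cycle_sign ^ p' * long_cycle_sign ^ q'" for p' q'
  proof (intro exI conjI)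
    show "cycle_counts (length (e # w)) u v p' q'" using that(1) by simp
    have "walk_sign S (e # w) =
        path_sign v * (arc_sign S (u, x) * path_sign x * short_cycle_sign ^ p * long_cycle_sign ^ q)"
      by (simp only: e walk_sign_Cons sign mult_ac)
    also have "\<dots> = path_sign u * path_sign v * short_cycle_sign ^ p' * long_cycle_sign ^ q'"
      unfolding sign' by (simp only: mult_ac)
    finally show "walk_sign S (e # w) =
        path_sign u * path_sign v * short_cycle_sign ^ p' * long_cycle_sign ^ q'" .
  qed
  consider (path) "1 \<le> u" "u < n" "x = Suc u" | (long) "u = n" "x = 1" | (short) "u = n - 1" "x = 1"
    using arc by (auto simp: arc_iff)
  then show ?case
  proof cases
    case path
    have "cycle_counts (Suc (length w)) u v p q"
      using path counts by (simp add: cycle_counts_def)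
    then show ?thesis
      by (rule step) (simp only: path arc_sign_path_mult[OF path(1,2)])
  next
    case long
    have "cycle_counts (Suc (length w)) u v p (Suc q)"
      using long counts by (simp add: cycle_counts_def)
    then show ?thesis
      by (rule step) (simp only: long path_sign_1 arc_sign_long power_Suc mult_ac mult_1)
  next
    case short
    have "cycle_counts (Suc (length w)) u v (Suc p) q"
      using short counts n_ge_2 by (auto simp: cycle_counts_def)
    then show ?thesis
      by (rule step) (simp only: short path_sign_1 arc_sign_short power_Suc mult_ac mult_1)
  qed
qed

text \<open>A greedy walk works: follow the path to \<open>n - 1\<close>, take the short cycle there
  while \<open>p\<close> is positive, and only then pass on to \<open>n\<close>. A walk that starts
  at \<open>n\<close> must first spend a long cycle.\<close>

lemma cycle_counts_imp_walk:
  assumes "u \<in> {1..n}" "v \<in> {1..n}" "cycle_counts m u v p q"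
  shows "\<exists>w. walk (D1 n) u w v \<and> length w = m \<and>
    walk_sign S w = path_sign u * path_sign v * short_cycle_sign ^ p * long_cycle_sign ^ q"
  using assms
proof (induction m arbitrary: u p q)
  case 0
  then have eq: "u = v + p * (n - 1) + q * n" by (simp add: cycle_counts_def)
  have q: "q = 0"
    using eq 0 by (cases q) auto
  have p: "p = 0"
  proof (cases p)
    case (Suc p')
    then have "u = v + (n - 1) + p' * (n - 1)" using eq q by simp
    \<comment> \<open>One short cycle already fills the whole distance from 1 to \<open>n\<close>;
      the start condition in \<open>cycle_counts\<close> rules this out.\<close>
    then have "u = n" using 0 n_ge_2 by auto
    then show ?thesis using 0 q by (simp add: cycle_counts_def)
  qed simp
  show ?case
    using 0 eq p q path_sign_square[of u]
    by (intro exI[of _ "[]"]) (simp add: walk_Nil walk_sign_def verts_eq)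
next
  case (Suc m)
  have eq: "Suc m + u = v + p * (n - 1) + q * n" and start: "u = n \<longrightarrow> 0 < p \<longrightarrow> 0 < q"
    using Suc.prems by (auto simp: cycle_counts_def)
  have step: ?case
    if arc: "(u, x) \<in> parcs (D1 n)" and x: "x \<in> {1..n}" and counts: "cycle_counts m x v p' q'"
      and sign: "arc_sign S (u, x) * path_sign x * short_cycle_sign ^ p' * long_cycle_sign ^ q' =
        path_sign u * short_cycle_sign ^ p * long_cycle_sign ^ q" for x p' q'
  proof -
    obtain w where w: "walk (D1 n) x w v" "length w = m"
      "walk_sign S w = path_sign x * path_sign v * short_cycle_sign ^ p' * long_cycle_sign ^ q'"
      using Suc.IH[OF x Suc.prems(2) counts] by blast
    have "walk_sign S ((u, x) # w) =
        path_sign v * (arc_sign S (u, x) * path_sign x * short_cycle_sign ^ p' * long_cycle_sign ^ q')"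
      by (simp only: walk_sign_Cons w(3) mult_ac)
    also have "\<dots> = path_sign u * path_sign v * short_cycle_sign ^ p * long_cycle_sign ^ q"
      unfolding sign by (simp only: mult_ac)
    finally show ?thesis
      using w arc by (intro exI[of _ "(u, x) # w"]) (simp add: walk_Cons[OF fin_digraph])
  qed
  \<comment> \<open>Entering \<open>n\<close> only when \<open>p = 0\<close> keeps the start
    condition true at the new vertex.\<close>
  have path_step: ?case if "u < n" "Suc u = n \<longrightarrow> p = 0"
  proof (rule step[of "Suc u" p q])
    show "arc_sign S (u, Suc u) * path_sign (Suc u) * short_cycle_sign ^ p * long_cycle_sign ^ q =
        path_sign u * short_cycle_sign ^ p * long_cycle_sign ^ q"
      using that Suc.prems arc_sign_path_mult[of u] by simp
    show "cycle_counts m (Suc u) v p q"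
      using that eq by (auto simp: cycle_counts_def)
  qed (use that Suc.prems(1) in \<open>auto simp: arc_iff\<close>)
  consider (path) "u < n" "Suc u = n \<longrightarrow> p = 0" | (short) p' where "u = n - 1" "p = Suc p'"
    | (long) q' where "u = n" "q = Suc q'" | (none) "u = n" "p = 0" "q = 0"
  proof (cases "u = n")
    case True
    show ?thesis
    proof (cases q)
      case 0
      then have "p = 0" using True start by simp
      with True 0 show ?thesis by (intro none)
    next
      case (Suc q')
      with True show ?thesis by (rule long)
    qed
  next
    case False
    then have "u < n" using Suc.prems(1) by simp
    show ?thesis
    proof (cases "Suc u = n \<and> p \<noteq> 0")
      case True
      then have "u = n - 1" "p = Suc (p - 1)" by auto
      then show ?thesis by (rule short)
    next
      case False
      with \<open>u < n\<close> show ?thesis by (intro path) auto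
    qed
  qed
  then show ?case
  proof cases
    case path
    then show ?thesis by (rule path_step)
  next
    case short
    show ?thesis
    proof (rule step[of 1 p' q])
      show "arc_sign S (u, 1) * path_sign 1 * short_cycle_sign ^ p' * long_cycle_sign ^ q =
          path_sign u * short_cycle_sign ^ p * long_cycle_sign ^ q"
        by (simp only: short path_sign_1 arc_sign_short power_Suc mult_ac mult_1)
      show "cycle_counts m 1 v p' q"
        using short eq n_ge_2 by (auto simp: cycle_counts_def)
    qed (use short n_ge_2 in \<open>auto simp: arc_iff\<close>)
  next
    case long
    show ?thesis
    proof (rule step[of 1 p q'])
      show "arc_sign S (u, 1) * path_sign 1 * short_cycle_sign ^ p * long_cycle_sign ^ q' =
          path_sign u * short_cycle_sign ^ p * long_cycle_sign ^ q"
        by (simp only: long path_sign_1 arc_sign_long power_Suc mult_ac mult_1)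
      show "cycle_counts m 1 v p q'"
        using long eq n_ge_2 by (auto simp: cycle_counts_def)
    qed (use long n_ge_2 in \<open>auto simp: arc_iff\<close>)
  next
    case none
    then show ?thesis using eq Suc.prems by simp
  qed
qed

section \<open>Exchanging short cycles for long ones\<close>

lemma cycle_counts_exchange:
  assumes "cycle_counts m u v p q" "cycle_counts m u v p' q'" "p' \<le> p"
  shows "\<exists>t. p = p' + t * n \<and> q' = q + t * (n - 1)"
proof -
  have eq: "p * (n - 1) + q * n = p' * (n - 1) + q' * n"
    using assms by (auto simp: cycle_counts_def)
  obtain d where d: "p = p' + d" using assms(3) le_Suc_ex by blast
  have eq': "d * (n - 1) + q * n = q' * n"
    using eq unfolding d by (simp add: add_mult_distrib)
  have "n dvd d * (n - 1)"
    using eq' by (metis dvd_add_left_iff dvd_triv_right)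
  moreover have "coprime n (n - 1)"
    using n_ge_2 by (intro coprime_diff_one_right_nat) simp
  ultimately have "n dvd d" by (simp add: coprime_dvd_mult_left_iff)
  then obtain t where t: "d = t * n" by (metis dvdE mult.commute)
  have "(q + t * (n - 1)) * n = t * n * (n - 1) + q * n"
    by (simp only: add_mult_distrib add_mult_distrib2 mult_ac add_ac)
  with eq' have "q' * n = (q + t * (n - 1)) * n" by (simp only: t)
  then have "q' = q + t * (n - 1)" using n_ge_2 by (simp only: mult_cancel2) auto
  with d t show ?thesis by blast
qed

lemma SSSD_pair_imp:
  assumes "SSSD_pair S m u v w w'"
  shows "short_cycle_sign ^ n \<noteq> long_cycle_sign ^ (n - 1)"
    and "\<exists>p q. cycle_counts m u v p q \<and> n \<le> p"
proof -
  have walks: "walk (D1 n) u w v" "walk (D1 n) u w' v" "length w = m" "length w' = m"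
    and neq: "walk_sign S w \<noteq> walk_sign S w'"
    using assms by (auto simp: SSSD_pair_def underlying)
  obtain p q where pq: "cycle_counts m u v p q"
    "walk_sign S w = path_sign u * path_sign v * short_cycle_sign ^ p * long_cycle_sign ^ q"
    using walk_imp_cycle_counts[OF walks(1)] walks by auto
  obtain p' q' where pq': "cycle_counts m u v p' q'"
    "walk_sign S w' = path_sign u * path_sign v * short_cycle_sign ^ p' * long_cycle_sign ^ q'"
    using walk_imp_cycle_counts[OF walks(2)] walks by auto
  \<comment> \<open>Stated for arbitrary counts, so that it applies to the two walks in either
    order.\<close>
  have "short_cycle_sign ^ n \<noteq> long_cycle_sign ^ (n - 1) \<and> n \<le> p1"
    if c1: "cycle_counts m u v p1 q1" and c2: "cycle_counts m u v p2 q2" and le: "p2 \<le> p1"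
      and ne: "short_cycle_sign ^ p1 * long_cycle_sign ^ q1 \<noteq>
               short_cycle_sign ^ p2 * long_cycle_sign ^ q2" for p1 q1 p2 q2
  proof -
    obtain t where t: "p1 = p2 + t * n" "q2 = q1 + t * (n - 1)"
      using cycle_counts_exchange[OF c1 c2 le] by blast
    have "(short_cycle_sign ^ n) ^ t \<noteq> (long_cycle_sign ^ (n - 1)) ^ t"
      using ne unfolding t by (auto simp: power_add power_mult[symmetric] mult_ac)
    moreover from this have "t \<noteq> 0" by (intro notI) simp
    ultimately show ?thesis using t by (cases t) auto
  qed
  note main = this
  have ne: "short_cycle_sign ^ p * long_cycle_sign ^ q \<noteq> short_cycle_sign ^ p' * long_cycle_sign ^ q'"
    using neq pq(2) pq'(2) by (auto simp: mult.assoc)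
  show "short_cycle_sign ^ n \<noteq> long_cycle_sign ^ (n - 1)"
    and "\<exists>p q. cycle_counts m u v p q \<and> n \<le> p"
    using main[OF pq(1) pq'(1) _ ne] main[OF pq'(1) pq(1) _ ne[symmetric]] pq(1) pq'(1)
      le_cases[of p p'] by blast+
qed

end

section \<open>SSSD walks in the non-powerful case\<close>

locale non_powerful_D1 = signed_D1 +
  assumes non_powerful: "non_powerful S"
begin

lemma cycle_signs: "short_cycle_sign ^ n \<noteq> long_cycle_sign ^ (n - 1)"
  using non_powerful SSSD_pair_imp(1) by (auto simp: non_powerful_def)

text \<open>Leaving \<open>n\<close> costs one long cycle, so \<open>n\<close> behaves like a vertex \<open>0\<close> preceding \<open>1\<close>; this
  is the reason for \<open>u mod n\<close>.\<close>

lemma SSSD_pair_iff: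
  assumes u: "u \<in> {1..n}" and v: "v \<in> {1..n}"
  shows "(\<exists>w w'. SSSD_pair S m u v w w') \<longleftrightarrow>
    (\<exists>p q. m + u mod n = v + n * (n - 1) + p * (n - 1) + q * n)"
proof -
  have "(\<exists>w w'. SSSD_pair S m u v w w') \<longleftrightarrow> (\<exists>p q. cycle_counts m u v p q \<and> n \<le> p)"
  proof
    assume "\<exists>p q. cycle_counts m u v p q \<and> n \<le> p"
    then obtain p q where c: "cycle_counts m u v (n + p) q"
      using le_Suc_ex by blast
    have "(n + p) * (n - 1) + q * n = p * (n - 1) + (q + (n - 1)) * n"
      by (simp only: add_mult_distrib add_mult_distrib2 mult_ac add_ac)
    \<comment> \<open>The start condition survives the exchange because \<open>n - 1\<close> is
      positive.\<close>
    then have "cycle_counts m u v p (q + (n - 1))"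
      using c n_ge_2 unfolding cycle_counts_def by linarith
    from cycle_counts_imp_walk[OF u v this] cycle_counts_imp_walk[OF u v c]
    obtain w w' where w: "walk (D1 n) u w v" "length w = m"
      "walk_sign S w = path_sign u * path_sign v * short_cycle_sign ^ p * long_cycle_sign ^ (q + (n - 1))"
      and w': "walk (D1 n) u w' v" "length w' = m"
      "walk_sign S w' = path_sign u * path_sign v * short_cycle_sign ^ (n + p) * long_cycle_sign ^ q"
      by blast
    have "path_sign u \<noteq> 0" "path_sign v \<noteq> 0" using u v by (simp_all add: path_sign_nz)
    then have "walk_sign S w \<noteq> walk_sign S w'"
      unfolding w(3) w'(3) using cycle_signs short_cycle_sign_nz long_cycle_sign_nz
      by (auto simp: power_add)
    then show "\<exists>w w'. SSSD_pair S m u v w w'"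
      using w(1,2) w'(1,2) unfolding SSSD_pair_def underlying by blast
  qed (use SSSD_pair_imp(2) in blast)
  also have "\<dots> \<longleftrightarrow> (\<exists>p q. cycle_counts m u v (n + p) q)"
    by (auto simp: le_iff_add)
  also have "\<dots> \<longleftrightarrow> (\<exists>p q. m + u mod n = v + n * (n - 1) + p * (n - 1) + q * n)"
  proof (cases "u = n")
    case True
    \<comment> \<open>As \<open>n + p\<close> is positive, the start condition forces a long cycle.
      Its length cancels against \<open>u = n\<close>, leaving \<open>u mod n = 0\<close>.\<close>
    have "cycle_counts m u v (n + p) (Suc q) \<longleftrightarrow> m + u mod n = v + n * (n - 1) + p * (n - 1) + q * n"
      for p q using True by (auto simp: cycle_counts_def add_mult_distrib)
    moreover have "\<not> cycle_counts m u v (n + p) 0" for p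
      using True n_ge_2 by (auto simp: cycle_counts_def)
    ultimately have "(\<exists>q. cycle_counts m u v (n + p) q) \<longleftrightarrow>
        (\<exists>q. m + u mod n = v + n * (n - 1) + p * (n - 1) + q * n)" for p
      by (metis not0_implies_Suc)
    then show ?thesis by simp
  next
    case False
    then have "u mod n = u" using u by simp
    then have "cycle_counts m u v (n + p) q \<longleftrightarrow>
        m + u mod n = v + n * (n - 1) + p * (n - 1) + q * n" for p q
      using False by (simp add: cycle_counts_def add_mult_distrib add_ac)
    then show ?thesis by simp
  qed
  finally show ?thesis .
qed

section \<open>Lengths at which a vertex set reaches every vertex\<close>

definition covers :: "nat set \<Rightarrow> nat \<Rightarrow> bool" where
  "covers X m \<longleftrightarrow> (\<forall>v \<in> {1..n}. \<exists>u \<in> X. \<exists>p q.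
     m + u mod n = v + n * (n - 1) + p * (n - 1) + q * n)"

lemma l_base_eq:
  assumes "X \<subseteq> {1..n}"
  shows "l_base S X = (LEAST m. covers X m)"
proof -
  have "(\<forall>v \<in> vertices S. \<exists>x \<in> X. \<exists>w w'. SSSD_pair S m x v w w') \<longleftrightarrow> covers X m" for m
  proof -
    have "vertices S = {1..n}" by (simp add: underlying verts_eq)
    moreover have "(\<exists>x \<in> X. \<exists>w w'. SSSD_pair S m x v w w') \<longleftrightarrow>
        (\<exists>u \<in> X. \<exists>p q. m + u mod n = v + n * (n - 1) + p * (n - 1) + q * n)"
      if "v \<in> {1..n}" for v
      using assms that by (intro bex_cong refl SSSD_pair_iff) auto
    ultimately show ?thesis by (simp only: covers_def cong: ball_cong)
  qed
  then show ?thesis by (simp add: l_base_def)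
qed

text \<open>Every vertex has an in-neighbour, \<open>v - 1\<close> for \<open>v > 1\<close> and
  \<open>n\<close> for \<open>v = 1\<close>, so the walks can be prolonged by a last arc. The arc
  from \<open>n\<close> to 1 completes a long cycle, whence \<open>Suc q\<close>.\<close>

lemma covers_Suc:
  assumes "covers X m"
  shows "covers X (Suc m)"
  unfolding covers_def
proof
  fix v assume v: "v \<in> {1..n}"
  show "\<exists>u \<in> X. \<exists>p q. Suc m + u mod n = v + n * (n - 1) + p * (n - 1) + q * n"
  proof (cases "v = 1")
    case True
    have "n \<in> {1..n}" using n_ge_2 by simp
    then obtain u p q where "u \<in> X" "m + u mod n = n + n * (n - 1) + p * (n - 1) + q * n"
      using assms unfolding covers_def by blast
    with True show ?thesis by (intro bexI[of _ u] exI[of _ p] exI[of _ "Suc q"]) simp_all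
  next
    case False
    then have "v - 1 \<in> {1..n}" using v by auto
    then obtain u p q where "u \<in> X" "m + u mod n = (v - 1) + n * (n - 1) + p * (n - 1) + q * n"
      using assms unfolding covers_def by blast
    with v show ?thesis by (intro bexI[of _ u] exI[of _ p] exI[of _ q]) auto
  qed
qed

lemma covers_mono:
  assumes "covers X m" "m \<le> m'"
  shows "covers X m'"
  using assms(2,1) by (induction rule: dec_induct) (auto intro: covers_Suc)

lemma inj_on_mod: "inj_on (\<lambda>u. u mod n) {1..n}"
proof (rule inj_onI)
  fix x y assume "x \<in> {1..n}" "y \<in> {1..n}" "x mod n = y mod n"
  then show "x = y" by (cases "x = n"; cases "y = n") auto
qed

lemma length_split:
  assumes "k \<le> n"
  shows "(2 * n - k) * (n - 1) = n * (n - 1) + (n - k) * (n - 1)"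
proof -
  have "2 * n - k = n + (n - k)" using assms by simp
  then show ?thesis by (simp add: add_mult_distrib)
qed

text \<open>Pigeonhole: \<open>X\<close> has \<open>k\<close> distinct residues modulo
  \<open>n\<close>, while at most \<open>k - 1\<close> residues fail to reach a given
  \<open>v\<close>.\<close>

lemma covers_upper:
  assumes "X \<subseteq> {1..n}" "card X = k" "1 \<le> k" "k \<le> n"
  shows "covers X ((2 * n - k) * (n - 1) + 1)"
  unfolding covers_def
proof
  fix v assume v: "v \<in> {1..n}"
  \<comment> \<open>The cyclic interval of residues from \<open>v - k\<close> to
    \<open>v - 2\<close> modulo \<open>n\<close>. Truncated subtraction starts the first piece at 0
    if \<open>v < k\<close>; the second piece is empty if \<open>v \<ge> k\<close>.\<close>
  let ?B = "{v - k..<v - 1} \<union> {v + n - k..<n}"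
  have "card ?B \<le> (v - 1 - (v - k)) + (n - (v + n - k))"
    by (metis card_Un_le card_atLeastLessThan)
  also have "\<dots> < k" using v assms by auto
  also have "k = card ((\<lambda>u. u mod n) ` X)"
    using assms inj_on_subset[OF inj_on_mod] by (simp add: card_image)
  finally have "\<not> (\<lambda>u. u mod n) ` X \<subseteq> ?B"
    by (metis card_mono finite_Un finite_atLeastLessThan not_le)
  then obtain u where u: "u \<in> X" and nB: "u mod n \<notin> ?B" by blast
  define r where "r = u mod n"
  have r: "r < n" using n_ge_2 by (simp add: r_def)
  have "\<exists>p q. (n - k) * (n - 1) + 1 + r = v + p * (n - 1) + q * n"
  \<comment> \<open>The target is \<open>(n - k) * (n - 1)\<close> plus the possibly negative excess
    \<open>1 + r - v\<close>. A nonnegative excess is at most \<open>n - k\<close> and lengthens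
    that many of the \<open>n - k\<close> short cycles by one. A negative one is treated with
    \<open>n - k - 1\<close> cycles, of which \<open>n + r - v\<close> are long.\<close>
  proof (cases "v - 1 \<le> r")
    case True
    then have "r < v + n - k" using nB r by (auto simp: r_def)
    then obtain p where p: "n - k = p + (1 + r - v)"
      using True v assms by (intro that[of "n - k - (1 + r - v)"]) auto
    define q where "q = 1 + r - v"
    have "1 + r = v + q" using True v by (auto simp: q_def)
    moreover have "q * (n - 1) + q = q * n" using n_ge_2 by (cases n) auto
    ultimately have "(n - k) * (n - 1) + 1 + r = v + p * (n - 1) + q * n"
      using p by (simp add: add_mult_distrib flip: q_def)
    then show ?thesis by blast
  next
    case False
    then have lt: "r < v - k" using nB by (auto simp: r_def)
    define q where "q = n + r - v"
    have q: "n + r = v + q" using v by (auto simp: q_def)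
    define p where "p = n - k - 1 - q"
    have p: "n - k = Suc (p + q)" using lt q v by (auto simp: p_def)
    have "q * (n - 1) + q = q * n" using n_ge_2 by (cases n) auto
    then have "(n - k) * (n - 1) + 1 + r = v + p * (n - 1) + q * n"
      unfolding p using q n_ge_2 by (simp add: add_mult_distrib)
    then show ?thesis by blast
  qed
  then have "\<exists>p q. (2 * n - k) * (n - 1) + 1 + u mod n = v + n * (n - 1) + p * (n - 1) + q * n"
    unfolding length_split[OF assms(4)] r_def by (simp add: add_ac)
  with u show "\<exists>u \<in> X. \<exists>p q. (2 * n - k) * (n - 1) + 1 + u mod n = v + n * (n - 1) + p * (n - 1) + q * n"
    by blast
qed

text \<open>For \<open>v = n\<close> the semigroup would have to contain
  \<open>(n - k) * (n - 1) - c\<close> with \<open>c = n - u mod n\<close>, which is one of 1, ...,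
  \<open>k - 1\<close> or equals \<open>n\<close>. Semigroup elements below
  \<open>(n - k) * (n - 1)\<close> are at most \<open>(n - k) * (n - 1) - k\<close>, so
  \<open>c < k\<close> falls in a gap; \<open>c = n\<close> gives the number just below
  \<open>(n - k - 1) * (n - 1)\<close>, in the preceding gap or negative.\<close>

lemma not_covers_last_vertices:
  assumes "1 \<le> k" "k \<le> n"
  shows "\<not> covers {n - k + 1..n} ((2 * n - k) * (n - 1))"
proof
  assume "covers {n - k + 1..n} ((2 * n - k) * (n - 1))"
  moreover have "n \<in> {1..n}" using n_ge_2 by simp
  ultimately obtain u p q where u: "u \<in> {n - k + 1..n}"
    and "(2 * n - k) * (n - 1) + u mod n = n + n * (n - 1) + p * (n - 1) + q * n"
    unfolding covers_def by blast
  then have "(n - k) * (n - 1) + u mod n = n + p * (n - 1) + q * n"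
    unfolding length_split[OF assms(2)] by simp
  moreover have "q * n = q * (n - 1) + q" using n_ge_2 by (cases n) auto
  ultimately have eq: "(n - k) * (n - 1) + u mod n = n + (p + q) * (n - 1) + q"
    by (simp add: add_mult_distrib)
  define c where "c = n - u mod n"
  have c: "n = u mod n + c" using n_ge_2 by (simp add: c_def)
  have c_bounds: "1 \<le> c" "c \<le> k - 1 \<or> c = n"
    using u n_ge_2 c by (cases "u = n"; auto simp: c_def)+
  have eq': "(n - k) * (n - 1) = (p + q) * (n - 1) + (q + c)"
    using eq c by simp
  then have "(p + q) * (n - 1) < (n - k) * (n - 1)" using c_bounds by simp
  then have "p + q < n - k" by simp
  \<comment> \<open>With \<open>d + 1\<close> cycles fewer than \<open>n - k\<close>, the deficit
    \<open>(d + 1) * (n - 1)\<close> must equal \<open>q + c\<close>, but \<open>q\<close> is at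
    most \<open>n - k - 1 - d\<close>.\<close>
  then obtain d where d: "n - k = p + q + Suc d" using less_iff_Suc_add by auto
  have eq'': "d * (n - 1) + (n - 1) = q + c"
    using eq' unfolding d by (simp add: add_mult_distrib)
  show False
  proof (cases "c = n")
    case True
    show False
    proof (cases d)
      case 0
      then show ?thesis using eq'' True n_ge_2 by simp
    next
      case (Suc d')
      then have "2 * (n - 1) \<le> q + n" using eq'' True by simp
      then show ?thesis using d Suc assms n_ge_2 by linarith
    qed
  next
    case False
    then have "n - 1 \<le> q + (k - 1)" using eq'' c_bounds by linarith
    then show False using d assms by linarith
  qed
qed

section \<open>The value of the upper base\<close>

lemma upper_base_eq:
  assumes "1 \<le> k" "k \<le> n"
  shows "upper_base S k = (2 * n - k) * (n - 1) + 1"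
  unfolding upper_base_def
proof (rule Max_eqI)
  have verts: "vertices S = {1..n}" by (simp add: underlying verts_eq)
  have "{l_base S X |X. X \<subseteq> vertices S \<and> card X = k} \<subseteq> l_base S ` Pow {1..n}"
    by (auto simp: verts)
  then show "finite {l_base S X |X. X \<subseteq> vertices S \<and> card X = k}"
    by (rule finite_subset) simp
  show "y \<le> (2 * n - k) * (n - 1) + 1"
    if y: "y \<in> {l_base S X |X. X \<subseteq> vertices S \<and> card X = k}" for y
  proof -
    obtain X where X: "X \<subseteq> {1..n}" "card X = k" and l: "y = l_base S X"
      using y unfolding verts by blast
    show ?thesis
      unfolding l l_base_eq[OF X(1)] using covers_upper[OF X assms] by (rule Least_le)
  qed
  let ?X = "{n - k + 1..n}"
  have X: "?X \<subseteq> {1..n}" "card ?X = k" using assms by auto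
  have "covers ?X (l_base S ?X)"
    unfolding l_base_eq[OF X(1)] using covers_upper[OF X assms] by (rule LeastI)
  \<comment> \<open>A smaller least length would, by monotonicity, also cover at the length just
    excluded.\<close>
  then have "\<not> l_base S ?X \<le> (2 * n - k) * (n - 1)"
    using not_covers_last_vertices[OF assms] covers_mono by blast
  moreover have "l_base S ?X \<le> (2 * n - k) * (n - 1) + 1"
    unfolding l_base_eq[OF X(1)] using covers_upper[OF X assms] by (rule Least_le)
  ultimately have "(2 * n - k) * (n - 1) + 1 = l_base S ?X" by linarith
  then show "(2 * n - k) * (n - 1) + 1 \<in> {l_base S X |X. X \<subseteq> vertices S \<and> card X = k}"
    using X unfolding verts by blast
qed

end

theorem theorem3p4:
  fixes S1 :: "nat signed_digraph" and n k :: nat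
  assumes "is_signed_digraph S1"
    and "underlying S1 = D1 n"
    and "primitive S1"
    and "non_powerful S1"
    and "1 \<le> k" and "k \<le> n"
  shows "upper_base S1 k = (2 * n - k) * (n - 1) + 1"
proof -
  interpret non_powerful_D1 S1 n
    using assms by unfold_locales
  show ?thesis using assms(5,6) by (rule upper_base_eq)
qed

end
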